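(* Let $(X,d_X)$ with $X=\bigcup_{Y\in\mathfrak{PL}^1}Y$ be the metric space of pseudo-linear quadruples described in the context, with $X\cap\mathbb{R}=\varnothing$. Let $p\in\mathbb{R}$, $b\in X$, $r\in(0,\infty)$, let $M=X\cup\mathbb{R}$, and let $d_M:M\times M\to[0,\infty)$ be the symmetric function with $$d_M(x,y)=\begin{cases} d_X(x,y) & \text{if } x,y\in X,\\ |x-y| & \text{if } x,y\in\mathbb{R},\\ |x-p|+r+d_X(b,y) & \text{if } x\in\mathbb{R} \text{ and } y\in X.\end{cases}$$ Then the metric space $(M,d_M)$ is minimal $\mathfrak{MB}$-universal.
   Context: For metric spaces $X,Y$, write $X\hookrightarrow Y$ if there is an isometric embedding (distance-preserving map) of $X$ in $Y$, and $X\simeq Y$ if $X$ and $Y$ are isometric. For metric spaces, $X\subseteq Y$ means that $X$ is a subspace of $Y$ with the induced metric. A metric space $Y$ is universal for a class $\mathfrak{M}$ of metric spaces ($\mathfrak{M}$-universal, written $\mathfrak{M}\hookrightarrow Y$) if $Z\hookrightarrow Y$ for every $Z\in\mathfrak{M}$; it is minimal $\mathfrak{M}$-universal if moreover for every subspace $Y_0\subseteq Y$, $\mathfrak{M}\hookrightarrow Y_0$ implies $Y_0=Y$. $\mathfrak{MB}$ is the class of metric spaces $X$ such that for all $x,y,z\in X$, $2\max\{d_X(x,y),d_X(x,z),d_X(y,z)\}=d_X(x,y)+d_X(x,z)+d_X(y,z)$, i.e. among any three points one lies between the other two. A metric space $Q$ is a pseudo-linear quadruple if $Q\not\hookrightarrow\mathbb{R}$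 and $A\hookrightarrow\mathbb{R}$ for every $A\subseteq Q$ with $|A|\le 3$. (Equivalently, $|Q|=4$ and the points can be labeled $p_0,p_1,p_2,p_3$ so that $d_Q(p_0,p_1)=d_Q(p_2,p_3)$, $d_Q(p_1,p_2)=d_Q(p_3,p_0)$ and $d_Q(p_0,p_2)=d_Q(p_0,p_1)+d_Q(p_1,p_2)=d_Q(p_1,p_3)$.) $\mathfrak{PL}$ is the class of all pseudo-linear quadruples. $\mathfrak{PL}^1\subseteq\mathfrak{PL}$ is a fixed set of pairwise disjoint pseudo-linear quadruples that is a minimal $\mathfrak{PL}$-universal class, in the following sense. For classes $\mathfrak{N},\mathfrak{B}$ of metric spaces, $\mathfrak{N}\hookrightarrow\mathfrak{B}$ means every $Z\in\mathfrak{N}$ satisfies $Z\hookrightarrow Y$ for some $Y\in\mathfrak{B}$, and $\mathfrak{N}\preceq\mathfrak{B}$ means every $Z\in\mathfrak{N}$ satisfies $Z\subseteq Y$ for some $Y\in\mathfrak{B}$; $\mathfrak{A}$ is minimal $\mathfrak{N}$-universal if $\mathfrak{N}\hookrightarrow\mathfrak{A}$, if for every class $\mathfrak{B}$ of metric spaces $(\mathfrak{N}\hookrightarrow\mathfrak{B})\wedge(\mathfrak{B}\preceq\mathfrak{A})$ implies $\mathfrak{A}\preceq\mathfrak{B}$, and if for distinct $Y,Z\in\mathfrak{A}$ neither $Y\hookrightarrow Z$ nor $Z\hookrightarrow Y$. (Thus every pseudo-linear quadruple is isometric to exactly one member of $\mathfrak{PL}^1$.) The metric $d_X$ on $X=\bigcup_{Y\in\mathfrak{PL}^1}Y$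 is: $d_X(z,y)=d_Y(z,y)$ if $z,y\in Y$ for some $Y\in\mathfrak{PL}^1$; and $d_X(z,y)=\max\{\operatorname{diam}Y,\operatorname{diam}Z\}$ if $y\in Y$, $z\in Z$ for distinct $Y,Z\in\mathfrak{PL}^1$. The functions $d_X$ and $d_M$ are metrics. *)

theory Defs
  imports "HOL-Analysis.Analysis"
begin

subsection \<open>Embeddings and universal spaces\<close>

definition isometrically_embeds :: "'a metric \<Rightarrow> 'b metric \<Rightarrow> bool" where
  "isometrically_embeds X Y \<longleftrightarrow>
     (\<exists>f. f ` mspace X \<subseteq> mspace Y \<and>
          (\<forall>x\<in>mspace X. \<forall>y\<in>mspace X. mdist Y (f x) (f y) = mdist X x y))"

text \<open>
  The values of \<open>mdist Z\<close> outside \<open>mspace Z\<close> are arbitrary, so being a subspace is expressed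
  by agreement on the carrier and not by \<open>Z = submetric Y (mspace Z)\<close>.
\<close>

definition is_subspace :: "'a metric \<Rightarrow> 'a metric \<Rightarrow> bool" where
  "is_subspace Z Y \<longleftrightarrow>
     mspace Z \<subseteq> mspace Y \<and> (\<forall>x\<in>mspace Z. \<forall>y\<in>mspace Z. mdist Z x y = mdist Y x y)"

definition universal_for :: "'a metric set \<Rightarrow> 'b metric \<Rightarrow> bool" where
  "universal_for \<MM> Y \<longleftrightarrow> (\<forall>Z\<in>\<MM>. isometrically_embeds Z Y)"

definition minimal_universal :: "'a metric set \<Rightarrow> 'b metric \<Rightarrow> bool" where
  "minimal_universal \<MM> Y \<longleftrightarrow>
     universal_for \<MM> Y \<and>
     (\<forall>Y\<^sub>0\<subseteq>mspace Y. universal_for \<MM> (submetric Y Y\<^sub>0) \<longrightarrow> Y\<^sub>0 = mspace Y)"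

subsection \<open>Universal classes\<close>

definition class_embeds :: "'a metric set \<Rightarrow> 'b metric set \<Rightarrow> bool" where
  "class_embeds \<NN> \<BB> \<longleftrightarrow> (\<forall>Z\<in>\<NN>. \<exists>Y\<in>\<BB>. isometrically_embeds Z Y)"

definition class_preceq :: "'a metric set \<Rightarrow> 'a metric set \<Rightarrow> bool" where
  "class_preceq \<NN> \<BB> \<longleftrightarrow> (\<forall>Z\<in>\<NN>. \<exists>Y\<in>\<BB>. is_subspace Z Y)"

text \<open>
  Letting \<open>\<BB>\<close> range over sets of spaces carried by the type of \<open>\<AA>\<close> is no restriction:
  \<open>\<BB> \<preceq> \<AA>\<close> forces every member of \<open>\<BB>\<close> to be a subspace of a member of \<open>\<AA>\<close>.
\<close>

definition minimal_universal_class :: "'a metric set \<Rightarrow> 'b metric set \<Rightarrow> bool" where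
  "minimal_universal_class \<NN> \<AA> \<longleftrightarrow>
     class_embeds \<NN> \<AA> \<and>
     (\<forall>\<BB>. class_embeds \<NN> \<BB> \<and> class_preceq \<BB> \<AA> \<longrightarrow> class_preceq \<AA> \<BB>) \<and>
     (\<forall>Y\<in>\<AA>. \<forall>Z\<in>\<AA>. Y \<noteq> Z \<longrightarrow>
        \<not> isometrically_embeds Y Z \<and> \<not> isometrically_embeds Z Y)"

subsection \<open>Metric betweenness spaces and pseudo-linear quadruples\<close>

text \<open>
  The classes \<open>MB\<close> and \<open>PL\<close> consist of the spaces carried by subsets of a type. For
  \<open>PL\<close> any type with at least four elements realizes all isometry types. The members of
  \<open>MB\<close> have at most continuum many points, so any type into which the reals inject
  realizes all isometry types; a smaller type would not contain a copy of the real line.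
\<close>

definition MB :: "'a metric set" where
  "MB = {X. \<forall>x\<in>mspace X. \<forall>y\<in>mspace X. \<forall>z\<in>mspace X.
           2 * Max {mdist X x y, mdist X x z, mdist X y z}
             = mdist X x y + mdist X x z + mdist X y z}"

definition pseudo_linear_quadruple :: "'a metric \<Rightarrow> bool" where
  "pseudo_linear_quadruple Q \<longleftrightarrow>
     \<not> isometrically_embeds Q (euclidean_metric :: real metric) \<and>
     (\<forall>A\<subseteq>mspace Q. finite A \<and> card A \<le> 3 \<longrightarrow>
        isometrically_embeds (submetric Q A) (euclidean_metric :: real metric))"

definition PL :: "'a metric set" where
  "PL = {Q. pseudo_linear_quadruple Q}"

subsection \<open>The union of a set of disjoint spaces\<close>

text \<open>The analogue of \<^const>\<open>diameter\<close> for \<^typ>\<open>'a metric\<close>; meaningful for bounded spaces.\<close>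

definition mdiameter :: "'a metric \<Rightarrow> real" where
  "mdiameter Y = (if mspace Y = {} then 0
                  else SUP (x, y)\<in>mspace Y \<times> mspace Y. mdist Y x y)"

definition member_at :: "'a metric set \<Rightarrow> 'a \<Rightarrow> 'a metric" where
  "member_at \<SS> x = (THE Y. Y \<in> \<SS> \<and> x \<in> mspace Y)"

text \<open>
  The locale \<^locale>\<open>Metric_space\<close> demands nonnegativity and symmetry of the distance function
  on the whole type; hence the value \<open>0\<close> off the carrier.
\<close>

definition union_dist :: "'a metric set \<Rightarrow> 'a \<Rightarrow> 'a \<Rightarrow> real" where
  "union_dist \<SS> z y =
     (if z \<in> (\<Union>Y\<in>\<SS>. mspace Y) \<and> y \<in> (\<Union>Y\<in>\<SS>. mspace Y) then
        (if member_at \<SS> z = member_at \<SS> y then mdist (member_at \<SS> z) z y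
         else max (mdiameter (member_at \<SS> z)) (mdiameter (member_at \<SS> y)))
      else 0)"

definition union_metric :: "'a metric set \<Rightarrow> 'a metric" where
  "union_metric \<SS> = metric (\<Union>Y\<in>\<SS>. mspace Y, union_dist \<SS>)"

lemma member_at_eq:
  assumes "disjoint_family_on mspace \<SS>" "Y \<in> \<SS>" "x \<in> mspace Y"
  shows "member_at \<SS> x = Y"
  unfolding member_at_def
  using assms by (intro the_equality) (auto simp: disjoint_family_on_def)

lemma mdist_le_mdiameter:
  assumes "finite (mspace Y)" "x \<in> mspace Y" "y \<in> mspace Y"
  shows "mdist Y x y \<le> mdiameter Y"
proof -
  have "mdist Y x y \<le> (SUP (x, y)\<in>mspace Y \<times> mspace Y. mdist Y x y)"
    using assms by (intro cSUP_upper2[where x = "(x, y)"]) (auto intro!: bdd_above_finite)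
  then show ?thesis
    using assms by (auto simp: mdiameter_def)
qed

lemma pseudo_linear_quadruple_nontrivial:
  assumes "pseudo_linear_quadruple Q" "x \<in> mspace Q"
  obtains y where "y \<in> mspace Q" "y \<noteq> x"
proof (rule ccontr)
  assume "\<not> thesis"
  then have "mspace Q = {x}"
    using that assms(2) by blast
  then have "isometrically_embeds Q (euclidean_metric :: real metric)"
    unfolding isometrically_embeds_def using assms(2)
    by (intro exI[of _ "\<lambda>_. 0"]) auto
  with assms(1) show False
    by (simp add: pseudo_linear_quadruple_def)
qed

lemma Metric_space_union_dist:
  fixes \<SS> :: "'a metric set"
  assumes disj: "disjoint_family_on mspace \<SS>" and sub: "\<SS> \<subseteq> PL"
    and fin: "\<And>Y. Y \<in> \<SS> \<Longrightarrow> finite (mspace Y)"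
  shows "Metric_space (\<Union>Y\<in>\<SS>. mspace Y) (union_dist \<SS>)"
proof -
  define X where "X = (\<Union>Y\<in>\<SS>. mspace Y)"
  have mem: "member_at \<SS> x \<in> \<SS>" "x \<in> mspace (member_at \<SS> x)" if "x \<in> X" for x
    using that member_at_eq[OF disj] by (auto simp: X_def)
  have le: "mdist (member_at \<SS> x) x y \<le> mdiameter (member_at \<SS> x)"
    if "x \<in> X" "y \<in> X" "member_at \<SS> x = member_at \<SS> y" for x y
    using that mem[of x] mem[of y] fin by (intro mdist_le_mdiameter) auto
  have pos: "0 < mdiameter (member_at \<SS> x)" if x: "x \<in> X" for x
  proof -
    have "pseudo_linear_quadruple (member_at \<SS> x)"
      using mem[OF x] sub by (auto simp: PL_def)
    then obtain y where y: "y \<in> mspace (member_at \<SS> x)" "y \<noteq> x"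
      using mem[OF x] by (metis pseudo_linear_quadruple_nontrivial)
    have "0 < mdist (member_at \<SS> x) x y"
      using mem[OF x] y by (metis mdist_nonneg mdist_zero order_le_less)
    also have "\<dots> \<le> mdiameter (member_at \<SS> x)"
      using mem[OF x] y fin by (intro mdist_le_mdiameter) auto
    finally show ?thesis .
  qed
  have dist: "union_dist \<SS> x y =
     (if x \<in> X \<and> y \<in> X then
        (if member_at \<SS> x = member_at \<SS> y then mdist (member_at \<SS> x) x y
         else max (mdiameter (member_at \<SS> x)) (mdiameter (member_at \<SS> y)))
      else 0)" for x y
    unfolding union_dist_def X_def by simp
  have "Metric_space X (union_dist \<SS>)"
  proof
    show "0 \<le> union_dist \<SS> x y" for x y
      using pos[of x] by (auto simp: dist)
    show "union_dist \<SS> x y = union_dist \<SS> y x" for x y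
      by (simp add: dist mdist_commute max.commute)
    show "(union_dist \<SS> x y = 0) = (x = y)" if "x \<in> X" "y \<in> X" for x y
      using that pos[of x] pos[of y] mem[of x] mem[of y] by (auto simp: dist)
    show "union_dist \<SS> x z \<le> union_dist \<SS> x y + union_dist \<SS> y z"
      if xyz: "x \<in> X" "y \<in> X" "z \<in> X" for x y z
    proof (cases "member_at \<SS> x = member_at \<SS> y \<and> member_at \<SS> y = member_at \<SS> z")
      case True
      then show ?thesis
        using xyz mem[of x] mem[of y] mem[of z]
        by (simp add: dist mdist_triangle)
    next
      case False
      then show ?thesis
        using xyz pos[of x] pos[of y] pos[of z] le[of x z]
          mdist_nonneg[of "member_at \<SS> x" x y] mdist_nonneg[of "member_at \<SS> y" y z]
        unfolding dist by (auto simp: max_def)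
    qed
  qed
  then show ?thesis
    by (simp add: X_def)
qed

subsection \<open>Attaching the real line to a space\<close>

text \<open>
  The disjoint union of the space and the line is rendered by the sum type: \<^const>\<open>Inl\<close>
  tags points of the space and \<^const>\<open>Inr\<close> tags reals.
\<close>

fun line_dist :: "'a metric \<Rightarrow> 'a \<Rightarrow> real \<Rightarrow> real \<Rightarrow> 'a + real \<Rightarrow> 'a + real \<Rightarrow> real" where
  "line_dist X b p r (Inl x) (Inl y) = mdist X x y"
| "line_dist X b p r (Inr s) (Inr t) = \<bar>s - t\<bar>"
| "line_dist X b p r (Inr s) (Inl y) = \<bar>s - p\<bar> + r + mdist X b y"
| "line_dist X b p r (Inl y) (Inr s) = \<bar>s - p\<bar> + r + mdist X b y"

definition line_metric :: "'a metric \<Rightarrow> 'a \<Rightarrow> real \<Rightarrow> real \<Rightarrow> ('a + real) metric" where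
  "line_metric X b p r = metric (mspace X <+> UNIV, line_dist X b p r)"

lemma Metric_space_line_dist:
  assumes b: "b \<in> mspace X" and r: "0 < r"
  shows "Metric_space (mspace X <+> UNIV) (line_dist X b p r)"
proof
  show "0 \<le> line_dist X b p r x y" for x y
    using r by (cases x; cases y) auto
  show "line_dist X b p r x y = line_dist X b p r y x" for x y
    by (cases x; cases y) (auto simp: mdist_commute)
  show "(line_dist X b p r x y = 0) = (x = y)"
    if "x \<in> mspace X <+> UNIV" "y \<in> mspace X <+> UNIV" for x y
  proof -
    have "\<bar>s - p\<bar> + r + mdist X b u \<noteq> 0" for s u
      using r mdist_nonneg[of X b u] by linarith
    then show ?thesis
      using that by (cases x; cases y) auto
  qed
  show "line_dist X b p r x z \<le> line_dist X b p r x y + line_dist X b p r y z"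
    if "x \<in> mspace X <+> UNIV" "y \<in> mspace X <+> UNIV" "z \<in> mspace X <+> UNIV" for x y z
  proof -
    have tri: "mdist X u w \<le> mdist X u v + mdist X v w"
      if "u \<in> mspace X" "v \<in> mspace X" "w \<in> mspace X" for u v w
      using that by (rule mdist_triangle)
    show ?thesis
      using that r b
      by (cases x; cases y; cases z)
         (auto simp: mdist_commute intro: mdist_triangle,
          (smt (verit) tri mdist_commute mdist_nonneg)+)
  qed
qed

lemma mspace_line_metric [simp]:
  assumes "b \<in> mspace X" "0 < r"
  shows "mspace (line_metric X b p r) = mspace X <+> UNIV"
  unfolding line_metric_def
  by (rule Metric_space.mspace_metric[OF Metric_space_line_dist[OF assms]])

lemma mdist_line_metric [simp]:
  assumes "b \<in> mspace X" "0 < r"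
  shows "mdist (line_metric X b p r) = line_dist X b p r"
  unfolding line_metric_def
  by (rule Metric_space.mdist_metric[OF Metric_space_line_dist[OF assms]])

end

theory Submission
  imports Defs
begin

text \<open>
  The proof rests on Menger's theorem for the line (\<open>MB_not_linear_imp_pl_cycle\<close>): a space in
  which every triple is degenerate either embeds in \<open>\<real>\<close> or consists of four points placed on
  a cycle with side lengths \<open>\<alpha>, \<beta>, \<alpha>, \<beta>\<close> and both diagonals \<open>\<alpha> + \<beta>\<close>. So the
  members of \<open>MB\<close> are, up to isometry, the subspaces of the line and the pseudo-linear
  quadruples. The line extension contains \<open>\<real>\<close> and one copy of each quadruple, hence is universal.

  For minimality it must be shown that neither part can be embedded in any other way. The line:
  points of the union of quadruples are isolated, and a copy of \<open>\<real>\<close> has no isolated points, so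
  it lies in the real part, where it must be everything because an isometry of \<open>\<real>\<close> into itself
  is surjective (\<open>line_metric_contains_line\<close>). A quadruple: a cycle of the above kind
  cannot contain both real and non-real points, since the detour of length \<open>r\<close> is added to every
  distance between the two parts (\<open>pl_cycle_in_line_metric\<close>). It cannot be distributed over
  several quadruples either, because their mutual distances are as large as the diameters and the
  greatest distance of a cycle is attained on its diagonals only (\<open>pl_cycle_in_union\<close>). Hence
  a copy of a member \<open>Q\<close> of the minimal class lies inside a single member, which is \<open>Q\<close>
  because distinct members do not embed in each other, and it fills \<open>Q\<close> because \<open>Q\<close> is
  finite.
\<close>

section \<open>Isometric embeddings and copies\<close>

lemma isometrically_embeds_trans:
  assumes "isometrically_embeds X Y" "isometrically_embeds Y Z"
  shows "isometrically_embeds X Z"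
proof -
  obtain f where f: "f ` mspace X \<subseteq> mspace Y"
    "\<And>x y. x \<in> mspace X \<Longrightarrow> y \<in> mspace X \<Longrightarrow> mdist Y (f x) (f y) = mdist X x y"
    using assms(1) unfolding isometrically_embeds_def by blast
  obtain g where g: "g ` mspace Y \<subseteq> mspace Z"
    "\<And>x y. x \<in> mspace Y \<Longrightarrow> y \<in> mspace Y \<Longrightarrow> mdist Z (g x) (g y) = mdist Y x y"
    using assms(2) unfolding isometrically_embeds_def by blast
  show ?thesis
    unfolding isometrically_embeds_def using f g by (intro exI[of _ "g \<circ> f"]) (auto simp: image_subset_iff)
qed

lemma isometry_inj_on:
  assumes "f ` mspace X \<subseteq> mspace Y"
    and "\<And>x y. x \<in> mspace X \<Longrightarrow> y \<in> mspace X \<Longrightarrow> mdist Y (f x) (f y) = mdist X x y"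
  shows "inj_on f (mspace X)"
proof (rule inj_onI)
  fix x y assume "x \<in> mspace X" "y \<in> mspace X" "f x = f y"
  then show "x = y"
    using assms(2)[of x y] assms(1) mdist_zero[of "f x" Y "f y"] mdist_zero[of x X y]
    by (auto simp: image_subset_iff)
qed

text \<open>
  \<open>MB\<close> and \<open>PL\<close> are sets of spaces over one fixed type. Copies move a space to the
  type over which universality is known.
\<close>

lemma isometric_copy:
  fixes X :: "'a metric" and g :: "'a \<Rightarrow> 'b"
  assumes "inj_on g (mspace X)"
  obtains X' :: "'b metric" where "mspace X' = g ` mspace X"
    "\<And>x y. x \<in> mspace X \<Longrightarrow> y \<in> mspace X \<Longrightarrow> mdist X' (g x) (g y) = mdist X x y"
    "isometrically_embeds X X'" "isometrically_embeds X' X"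
proof -
  define h where "h = inv_into (mspace X) g"
  have h: "h (g x) = x" if "x \<in> mspace X" for x
    unfolding h_def by (rule inv_into_f_f[OF assms that])
  have "Metric_space (g ` mspace X) (\<lambda>u v. mdist X (h u) (h v))"
    by unfold_locales (auto simp: h mdist_commute intro: mdist_triangle)
  then have X': "mspace (metric (g ` mspace X, \<lambda>u v. mdist X (h u) (h v))) = g ` mspace X"
    "mdist (metric (g ` mspace X, \<lambda>u v. mdist X (h u) (h v))) = (\<lambda>u v. mdist X (h u) (h v))"
    by (auto simp: Metric_space.mspace_metric Metric_space.mdist_metric)
  show thesis
  proof (rule that[OF X'(1)])
    show "isometrically_embeds X (metric (g ` mspace X, \<lambda>u v. mdist X (h u) (h v)))"
      unfolding isometrically_embeds_def X' by (intro exI[of _ g]) (auto simp: h)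
    show "isometrically_embeds (metric (g ` mspace X, \<lambda>u v. mdist X (h u) (h v))) X"
      unfolding isometrically_embeds_def X' by (intro exI[of _ h]) (auto simp: h)
  qed (simp add: X' h)
qed

section \<open>Betweenness spaces off the line are pseudo-linear quadruples\<close>

lemma twice_Max_eq_sum_iff:
  fixes a b c :: real
  assumes "0 \<le> a" "0 \<le> b" "0 \<le> c"
  shows "2 * Max {a, b, c} = a + b + c \<longleftrightarrow> a = b + c \<or> b = a + c \<or> c = a + b"
  using assms by (auto simp: max_def)

text \<open>
  Membership in \<open>MB\<close> as a disjunction of linear equations, the form in which linear
  arithmetic can use it.
\<close>

lemma MB_iff:
  "X \<in> MB \<longleftrightarrow> (\<forall>x\<in>mspace X. \<forall>y\<in>mspace X. \<forall>z\<in>mspace X.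
     mdist X x y = mdist X x z + mdist X y z \<or>
     mdist X x z = mdist X x y + mdist X y z \<or>
     mdist X y z = mdist X x y + mdist X x z)"
  unfolding MB_def by (simp add: twice_Max_eq_sum_iff del: Max_insert)

lemma MB_embeds:
  assumes "isometrically_embeds X Y" "Y \<in> MB"
  shows "X \<in> MB"
proof -
  obtain f where f: "f ` mspace X \<subseteq> mspace Y"
    "\<And>x y. x \<in> mspace X \<Longrightarrow> y \<in> mspace X \<Longrightarrow> mdist Y (f x) (f y) = mdist X x y"
    using assms(1) unfolding isometrically_embeds_def by blast
  show ?thesis
    unfolding MB_iff
  proof (intro ballI)
    fix x y z assume xyz: "x \<in> mspace X" "y \<in> mspace X" "z \<in> mspace X"
    with f(1) have fxyz: "f x \<in> mspace Y" "f y \<in> mspace Y" "f z \<in> mspace Y"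
      by auto
    show "mdist X x y = mdist X x z + mdist X y z \<or>
       mdist X x z = mdist X x y + mdist X y z \<or> mdist X y z = mdist X x y + mdist X x z"
      using assms(2)[unfolded MB_iff, rule_format, OF fxyz] xyz by (simp only: f(2))
  qed
qed

lemma euclidean_real_in_MB: "(euclidean_metric :: real metric) \<in> MB"
  unfolding MB_iff by (auto simp: dist_real_def)

text \<open>
  The labelled form of a pseudo-linear quadruple. It refers to a distance function and four points
  instead of a space, so that it also applies to the image of a quadruple in a larger space.
\<close>

definition pl_cycle :: "('a \<Rightarrow> 'a \<Rightarrow> real) \<Rightarrow> 'a \<Rightarrow> 'a \<Rightarrow> 'a \<Rightarrow> 'a \<Rightarrow> bool" where
  "pl_cycle d p0 p1 p2 p3 \<longleftrightarrow>
     0 < d p0 p1 \<and> 0 < d p1 p2 \<and> d p2 p3 = d p0 p1 \<and> d p3 p0 = d p1 p2 \<and>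
     d p0 p2 = d p0 p1 + d p1 p2 \<and> d p1 p3 = d p0 p1 + d p1 p2"

lemma pl_cycle_rotate:
  assumes "pl_cycle d p0 p1 p2 p3" "d p2 p0 = d p0 p2"
  shows "pl_cycle d p1 p2 p3 p0"
  using assms unfolding pl_cycle_def by auto

text \<open>
  Two points \<open>a\<close>, \<open>b\<close> fix coordinates: if \<open>a\<close> is put at \<open>0\<close> and \<open>b\<close> at
  \<open>ab\<close>, a third point \<open>x\<close> has to be put at \<open>- ax\<close> or \<open>ax\<close>, depending on
  whether \<open>a\<close> lies between \<open>x\<close> and \<open>b\<close>. If these coordinates give the wrong
  distance between \<open>x\<close> and \<open>y\<close>, then the triples containing \<open>x\<close> and
  \<open>y\<close> force all three pairs of opposite distances to agree. Each way to choose the middle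
  points of the four triples is a linear problem.
\<close>

lemma four_points_off_line:
  fixes ab ax ay bx "by" xy :: real
  assumes "0 < ab" "0 \<le> ax" "0 \<le> ay" "0 \<le> bx" "0 \<le> by" "0 \<le> xy"
    and "ab = ax + bx \<or> ax = ab + bx \<or> bx = ab + ax"
    and "ab = ay + by \<or> ay = ab + by \<or> by = ab + ay"
    and "ax = ay + xy \<or> ay = ax + xy \<or> xy = ax + ay"
    and "bx = by + xy \<or> by = bx + xy \<or> xy = bx + by"
    and "\<bar>(if bx = ab + ax then - ax else ax) - (if by = ab + ay then - ay else ay)\<bar> \<noteq> xy"
  shows "xy = ab \<and> by = ax \<and> bx = ay \<and> 0 < ax \<and> 0 < ay"
  using assms by (smt (verit))

text \<open>
  The numbers \<open>z0, z1, z2, z3\<close> stand for the distances of a point \<open>z\<close> to the corners of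
  a cycle with sides \<open>\<alpha>\<close>, \<open>\<beta>\<close>, and the disjunctions for the degenerate triples
  formed by \<open>z\<close> and a side or a diagonal. If \<open>z\<close> were beyond the end \<open>p2\<close> of the
  diagonal from \<open>p0\<close>, it would be beyond \<open>p2\<close> as seen from \<open>p1\<close> and \<open>p3\<close>
  too, which is compatible with the other diagonal only for \<open>z = p2\<close>. If \<open>z\<close> is between
  the ends of both diagonals, the four sides leave only the corners.
\<close>

lemma pl_cycle_no_fifth_point:
  fixes \<alpha> \<beta> z0 z1 z2 z3 :: real
  assumes "0 < \<alpha>" "0 < \<beta>" "0 \<le> z0" "0 \<le> z1" "0 \<le> z2" "0 \<le> z3"
    and "\<alpha> = z0 + z1 \<or> z0 = \<alpha> + z1 \<or> z1 = \<alpha> + z0"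
    and "\<alpha> = z2 + z3 \<or> z2 = \<alpha> + z3 \<or> z3 = \<alpha> + z2"
    and "\<beta> = z1 + z2 \<or> z1 = \<beta> + z2 \<or> z2 = \<beta> + z1"
    and "\<beta> = z3 + z0 \<or> z3 = \<beta> + z0 \<or> z0 = \<beta> + z3"
    and "\<alpha> + \<beta> = z0 + z2 \<or> z0 = \<alpha> + \<beta> + z2 \<or> z2 = \<alpha> + \<beta> + z0"
    and "\<alpha> + \<beta> = z1 + z3 \<or> z1 = \<alpha> + \<beta> + z3 \<or> z3 = \<alpha> + \<beta> + z1"
  shows "z0 = 0 \<or> z1 = 0 \<or> z2 = 0 \<or> z3 = 0"
  using assms by (smt (verit))

text \<open>
  Menger's theorem for the line. If the coordinates with respect to two fixed points fail to be an
  isometry, they give a wrong distance for some pair, which together with the two fixed points forms a cycle;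
  a cycle leaves no room for a fifth point.
\<close>

lemma MB_not_linear_imp_pl_cycle:
  fixes X :: "'a metric"
  assumes MB: "X \<in> MB" and nl: "\<not> isometrically_embeds X (euclidean_metric :: real metric)"
  obtains p0 p1 p2 p3 where "mspace X = {p0, p1, p2, p3}" "distinct [p0, p1, p2, p3]"
    "pl_cycle (mdist X) p0 p1 p2 p3"
proof -
  let ?M = "mspace X"
  define d where "d = mdist X"
  have sym: "d x y = d y x" for x y
    by (simp add: d_def mdist_commute)
  have nn: "0 \<le> d x y" for x y
    by (simp add: d_def)
  have zero: "d x y = 0 \<longleftrightarrow> x = y" if "x \<in> ?M" "y \<in> ?M" for x y
    using that by (simp add: d_def)
  have T: "d x y = d x z + d y z \<or> d x z = d x y + d y z \<or> d y z = d x y + d x z"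
    if "x \<in> ?M" "y \<in> ?M" "z \<in> ?M" for x y z
    using MB that unfolding MB_iff d_def by blast
  have embI: False if "\<And>x y. x \<in> ?M \<Longrightarrow> y \<in> ?M \<Longrightarrow> \<bar>f x - f y\<bar> = d x y" for f :: "'a \<Rightarrow> real"
    using nl that unfolding isometrically_embeds_def d_def by (auto simp: dist_real_def)
  have "\<exists>a\<in>?M. \<exists>b\<in>?M. a \<noteq> b"
  proof (rule ccontr)
    assume "\<not> (\<exists>a\<in>?M. \<exists>b\<in>?M. a \<noteq> b)"
    then show False
      using embI[of "\<lambda>_. 0"] zero by fastforce
  qed
  then obtain a b where ab: "a \<in> ?M" "b \<in> ?M" "a \<noteq> b"
    by blast
  define f where "f x = (if d b x = d a b + d a x then - d a x else d a x)" for x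
  obtain x y where xy: "x \<in> ?M" "y \<in> ?M" "\<bar>f x - f y\<bar> \<noteq> d x y"
    using embI[of f] by blast
  have opp: "d x y = d a b \<and> d b y = d a x \<and> d b x = d a y \<and> 0 < d a x \<and> 0 < d a y"
  proof (rule four_points_off_line)
    show "0 < d a b"
      using zero[of a b] ab nn[of a b] by linarith
  qed (use nn xy(3) T[of a b x] T[of a b y] T[of a x y] T[of b x y] ab xy sym in \<open>auto simp: f_def\<close>)
  have ab0: "0 < d a b"
    using zero[of a b] ab nn[of a b] by linarith
  \<comment> \<open>The longest distance of the triple \<open>a, b, x\<close> becomes a diagonal of the cycle.\<close>
  obtain p0 p1 p2 p3 where p: "p0 \<in> ?M" "p1 \<in> ?M" "p2 \<in> ?M" "p3 \<in> ?M" "pl_cycle d p0 p1 p2 p3"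
  proof -
    consider "d a b = d a x + d b x" | "d a x = d a b + d b x" | "d b x = d a b + d a x"
      using T[of a b x] ab xy by blast
    then show thesis
    proof cases
      case 1
      then have "pl_cycle d a x b y"
        unfolding pl_cycle_def using opp sym[of x b] sym[of y a] by auto
      then show thesis using that ab xy by blast
    next
      case 2
      then have "pl_cycle d a b x y"
        unfolding pl_cycle_def using opp ab0 sym[of y a] by auto
      then show thesis using that ab xy by blast
    next
      case 3
      then have "pl_cycle d a b y x"
        unfolding pl_cycle_def using opp ab0 sym[of y x] sym[of x a] by auto
      then show thesis using that ab xy by blast
    qed
  qed
  have "z \<in> {p0, p1, p2, p3}" if z: "z \<in> ?M" for z
  proof -
    have e: "0 < d p0 p1" "0 < d p1 p2" "d p2 p3 = d p0 p1" "d p3 p0 = d p1 p2"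
      "d p0 p2 = d p0 p1 + d p1 p2" "d p1 p3 = d p0 p1 + d p1 p2"
      using p(5) unfolding pl_cycle_def by blast+
    have "d p0 z = 0 \<or> d p1 z = 0 \<or> d p2 z = 0 \<or> d p3 z = 0"
      by (rule pl_cycle_no_fifth_point[OF e(1,2) nn nn nn nn T[OF p(1,2) z]
            T[OF p(3,4) z, unfolded e] T[OF p(2,3) z] T[OF p(4,1) z, unfolded e]
            T[OF p(1,3) z, unfolded e] T[OF p(2,4) z, unfolded e]])
    then show ?thesis
      using zero z p by auto
  qed
  then have "?M = {p0, p1, p2, p3}"
    using p by auto
  moreover have "distinct [p0, p1, p2, p3]"
    using p(5) sym[of p3 p0] zero[OF p(1) p(1)] zero[OF p(2) p(2)] zero[OF p(3) p(3)]
    unfolding pl_cycle_def by (smt (verit) distinct_length_2_or_more distinct_singleton)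
  ultimately show thesis
    using that p(5) unfolding d_def by blast
qed

text \<open>
  That every subspace of at most three points of a space in \<open>MB\<close> is linear follows from
  Menger's theorem too: an exception would have four points.
\<close>

lemma pseudo_linear_quadruple_iff_MB:
  fixes Q :: "'a metric"
  shows "pseudo_linear_quadruple Q \<longleftrightarrow>
    Q \<in> MB \<and> \<not> isometrically_embeds Q (euclidean_metric :: real metric)"
proof (cases "isometrically_embeds Q (euclidean_metric :: real metric)")
  case True
  then show ?thesis
    by (simp add: pseudo_linear_quadruple_def)
next
  case False
  have "Q \<in> MB" if pl: "pseudo_linear_quadruple Q"
    unfolding MB_iff
  proof (intro ballI)
    fix x y z assume xyz: "x \<in> mspace Q" "y \<in> mspace Q" "z \<in> mspace Q"
    have "card {x, y, z} \<le> 3"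
      by (simp add: card_insert_if)
    with pl xyz have "isometrically_embeds (submetric Q {x, y, z}) (euclidean_metric :: real metric)"
      unfolding pseudo_linear_quadruple_def by simp
    from MB_embeds[OF this euclidean_real_in_MB] xyz
    show "mdist Q x y = mdist Q x z + mdist Q y z \<or>
       mdist Q x z = mdist Q x y + mdist Q y z \<or> mdist Q y z = mdist Q x y + mdist Q x z"
      unfolding MB_iff by (auto simp del: mdist_zero)
  qed
  moreover have "isometrically_embeds (submetric Q A) (euclidean_metric :: real metric)"
    if MB: "Q \<in> MB" and A: "A \<subseteq> mspace Q" "card A \<le> 3" for A
  proof (rule ccontr)
    assume nl: "\<not> isometrically_embeds (submetric Q A) (euclidean_metric :: real metric)"
    have "submetric Q A \<in> MB"
      using MB A unfolding MB_iff by auto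
    then obtain p0 p1 p2 p3 where "mspace (submetric Q A) = {p0, p1, p2, p3}"
      "distinct [p0, p1, p2, p3]"
      using nl by (rule MB_not_linear_imp_pl_cycle)
    with A(1) have "card A = card (set [p0, p1, p2, p3])" "distinct [p0, p1, p2, p3]"
      by (auto simp: Int_absorb2)
    then show False
      using A(2) distinct_card[of "[p0, p1, p2, p3]"] by simp
  qed
  ultimately show ?thesis
    using False unfolding pseudo_linear_quadruple_def by blast
qed

lemma PL_card:
  assumes "Q \<in> PL"
  shows "finite (mspace Q)" "card (mspace Q) = 4"
proof -
  obtain p0 p1 p2 p3 where "mspace Q = {p0, p1, p2, p3}" "distinct [p0, p1, p2, p3]"
    using assms by (auto simp: PL_def pseudo_linear_quadruple_iff_MB elim: MB_not_linear_imp_pl_cycle)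
  then show "finite (mspace Q)" "card (mspace Q) = 4"
    using distinct_card[of "[p0, p1, p2, p3]"] by auto
qed

section \<open>Quadruples in the union and in the line extension\<close>

lemma mspace_union_metric:
  assumes "disjoint_family_on mspace \<SS>" "\<SS> \<subseteq> PL"
  shows "mspace (union_metric \<SS>) = (\<Union>Y\<in>\<SS>. mspace Y)"
  using Metric_space.mspace_metric[OF Metric_space_union_dist[OF assms]] PL_card(1) assms(2)
  unfolding union_metric_def by blast

lemma mdist_union_metric:
  assumes "disjoint_family_on mspace \<SS>" "\<SS> \<subseteq> PL" "Y \<in> \<SS>" "Z \<in> \<SS>" "y \<in> mspace Y" "z \<in> mspace Z"
  shows "mdist (union_metric \<SS>) y z =
    (if Y = Z then mdist Y y z else max (mdiameter Y) (mdiameter Z))"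
proof -
  have "mdist (union_metric \<SS>) = union_dist \<SS>"
    using Metric_space.mdist_metric[OF Metric_space_union_dist[OF assms(1,2)]] PL_card(1) assms(2)
    unfolding union_metric_def by blast
  then show ?thesis
    using assms member_at_eq[OF assms(1)] by (auto simp: union_dist_def)
qed

text \<open>
  Start from a corner whose member has the greatest diameter. A corner in a different member is at
  distance equal to that diameter, which bounds all distances of the cycle. So such a corner could
  only be the opposite one, and then this distance would also occur as a side.
\<close>

lemma pl_cycle_in_union:
  assumes disj: "disjoint_family_on mspace \<SS>" and sub: "\<SS> \<subseteq> PL"
    and mem: "q0 \<in> mspace (union_metric \<SS>)" "q1 \<in> mspace (union_metric \<SS>)"
      "q2 \<in> mspace (union_metric \<SS>)" "q3 \<in> mspace (union_metric \<SS>)"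
    and cyc: "pl_cycle (mdist (union_metric \<SS>)) q0 q1 q2 q3"
  obtains Y where "Y \<in> \<SS>" "{q0, q1, q2, q3} \<subseteq> mspace Y"
proof -
  let ?d = "mdist (union_metric \<SS>)"
  define m where "m = member_at \<SS>"
  let ?U = "mspace (union_metric \<SS>)"
  have m: "m x \<in> \<SS>" "x \<in> mspace (m x)" if "x \<in> ?U" for x
    using that member_at_eq[OF disj] by (auto simp: m_def mspace_union_metric[OF disj sub])
  have apart: "?d x y = max (mdiameter (m x)) (mdiameter (m y))"
    if "x \<in> ?U" "y \<in> ?U" "m x \<noteq> m y" for x y
    using mdist_union_metric[OF disj sub m(1)[OF that(1)] m(1)[OF that(2)]
        m(2)[OF that(1)] m(2)[OF that(2)]] that(3) by simp
  have le: "?d x y \<le> max (mdiameter (m x)) (mdiameter (m y))" if "x \<in> ?U" "y \<in> ?U" for x y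
  proof (cases "m x = m y")
    case True
    have "?d x y = mdist (m x) x y"
      using mdist_union_metric[OF disj sub m(1)[OF that(1)] m(1)[OF that(2)]
          m(2)[OF that(1)] m(2)[OF that(2)]] True by simp
    also have "\<dots> \<le> mdiameter (m x)"
      using m[OF that(1)] m[OF that(2)] True PL_card(1) sub by (intro mdist_le_mdiameter) auto
    finally show ?thesis by simp
  qed (use apart that in auto)
  have one: "m q1 = m q0 \<and> m q2 = m q0 \<and> m q3 = m q0"
    if q: "q0 \<in> ?U" "q1 \<in> ?U" "q2 \<in> ?U" "q3 \<in> ?U" and c: "pl_cycle ?d q0 q1 q2 q3"
      and top: "mdiameter (m q1) \<le> mdiameter (m q0)" "mdiameter (m q2) \<le> mdiameter (m q0)"
        "mdiameter (m q3) \<le> mdiameter (m q0)"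
    for q0 q1 q2 q3
  proof -
    have 1: "?d q0 q2 \<le> mdiameter (m q0)" and lt: "?d q0 q1 < ?d q0 q2" "?d q3 q0 < ?d q0 q2"
      "?d q1 q2 < ?d q0 q2"
      using le[of q0 q2] q top c by (auto simp: pl_cycle_def)
    have "m q1 = m q0"
      using apart[of q0 q1] q top 1 lt by fastforce
    moreover have "m q3 = m q0"
      using apart[of q3 q0] q top 1 lt by fastforce
    moreover have "m q2 = m q0"
      using apart[of q1 q2] q top 1 lt calculation by fastforce
    ultimately show ?thesis by blast
  qed
  have sym: "?d x y = ?d y x" for x y
    by (rule mdist_commute)
  note cyc1 = pl_cycle_rotate[OF cyc sym]
  note cyc2 = pl_cycle_rotate[OF cyc1 sym]
  note cyc3 = pl_cycle_rotate[OF cyc2 sym]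
  have "m q1 = m q0 \<and> m q2 = m q0 \<and> m q3 = m q0"
    using one[OF mem cyc] one[OF mem(2,3,4,1) cyc1] one[OF mem(3,4,1,2) cyc2]
      one[OF mem(4,1,2,3) cyc3] by (smt (verit))
  then show thesis
    using that[of "m q0"] m[of q0] m[of q1] m[of q2] m[of q3] mem by auto
qed

text \<open>
  If both neighbours of a corner were in the other part, the diagonal between them would pass
  through that corner and contain the connecting segment of length \<open>r\<close> twice, although the
  path inside their own part is shorter. There remains the case that two adjacent corners are real
  and the other two are not; then the lengths of the two sides and of the two diagonals that
  connect the parts can be compared.
\<close>

lemma pl_cycle_in_line_metric:
  assumes b: "b \<in> mspace X" and r: "0 < r"
    and mem: "q0 \<in> mspace X <+> UNIV" "q1 \<in> mspace X <+> UNIV"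
      "q2 \<in> mspace X <+> UNIV" "q3 \<in> mspace X <+> UNIV"
    and cyc: "pl_cycle (line_dist X b p r) q0 q1 q2 q3"
  shows "{q0, q1, q2, q3} \<subseteq> range Inl \<or> {q0, q1, q2, q3} \<subseteq> range Inr"
proof -
  let ?d = "line_dist X b p r"
  have sym: "?d x y = ?d y x" for x y
    by (cases x; cases y) (auto simp: mdist_commute)
  have neighbour: "isl q0 = isl q1 \<or> isl q0 = isl q3"
    if q: "q0 \<in> mspace X <+> UNIV" "q1 \<in> mspace X <+> UNIV" "q3 \<in> mspace X <+> UNIV"
      and c: "pl_cycle ?d q0 q1 q2 q3" for q0 q1 q2 q3
  proof (rule ccontr)
    assume n: "\<not> ?thesis"
    have e: "?d q1 q3 = ?d q0 q1 + ?d q3 q0"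
      using c by (auto simp: pl_cycle_def)
    show False
    proof (cases q0)
      case (Inl y)
      with n obtain s t where "q1 = Inr s" "q3 = Inr t"
        by (cases q1; cases q3) auto
      with e Inl have "\<bar>s - t\<bar> = \<bar>s - p\<bar> + r + mdist X b y + (\<bar>t - p\<bar> + r + mdist X b y)"
        by simp
      with r show False
        using mdist_nonneg[of X b y] by linarith
    next
      case (Inr s)
      with n obtain y z where "q1 = Inl y" "q3 = Inl z"
        by (cases q1; cases q3) auto
      with e have "mdist X y z = \<bar>s - p\<bar> + r + mdist X b y + (\<bar>s - p\<bar> + r + mdist X b z)"
        using Inr by simp
      moreover have "mdist X y z \<le> mdist X b y + mdist X b z"
        using mdist_triangle[of y X b z] b q \<open>q1 = Inl y\<close> \<open>q3 = Inl z\<close>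
        by (auto simp: mdist_commute)
      ultimately show False
        using r by linarith
    qed
  qed
  have side: "\<not> (isl q0 = isl q1 \<and> isl q2 = isl q3 \<and> isl q0 \<noteq> isl q2)"
    if c: "pl_cycle ?d q0 q1 q2 q3" for q0 q1 q2 q3
  proof
    assume n: "isl q0 = isl q1 \<and> isl q2 = isl q3 \<and> isl q0 \<noteq> isl q2"
    have e: "?d q3 q0 = ?d q1 q2" "?d q0 q2 = ?d q1 q3" "?d q1 q2 < ?d q0 q2"
      using c by (auto simp: pl_cycle_def)
    \<comment> \<open>The first two equations say that the two corners of each part are equidistant from the
      connecting segment. Then the diagonals are no longer than the sides.\<close>
    show False
      using n e by (cases q0; cases q1; cases q2; cases q3) auto
  qed
  note cyc1 = pl_cycle_rotate[OF cyc sym]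
  note cyc2 = pl_cycle_rotate[OF cyc1 sym]
  note cyc3 = pl_cycle_rotate[OF cyc2 sym]
  have "isl q1 = isl q0 \<and> isl q2 = isl q0 \<and> isl q3 = isl q0"
    using neighbour[OF mem(1,2,4) cyc] neighbour[OF mem(2,3,1) cyc1] neighbour[OF mem(3,4,2) cyc2]
      neighbour[OF mem(4,1,3) cyc3] side[OF cyc] side[OF cyc1] by blast
  then show ?thesis
    by (cases q0; cases q1; cases q2; cases q3) auto
qed

section \<open>Copies of the line\<close>

lemma real_isometry_surj:
  fixes g :: "real \<Rightarrow> real"
  assumes "\<And>s t. \<bar>g s - g t\<bar> = \<bar>s - t\<bar>"
  shows "surj g"
  unfolding surj_def
proof
  fix y
  \<comment> \<open>Both arguments are at distance \<open>\<bar>y - g 0\<bar>\<close> from \<open>0\<close>. For \<open>y \<noteq> g 0\<close> their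
    values are the two points at this distance from \<open>g 0\<close>, one of which is \<open>y\<close>.\<close>
  have "y = g (y - g 0) \<or> y = g (g 0 - y)"
    using assms[of "y - g 0" 0] assms[of "g 0 - y" 0] assms[of "y - g 0" "g 0 - y"] by linarith
  then show "\<exists>x. y = g x" by blast
qed

text \<open>
  The distance to the nearest other point of the same quadruple isolates a point, since the points of
  the other quadruples are at least a diameter away.
\<close>

lemma union_metric_isolated:
  assumes disj: "disjoint_family_on mspace \<SS>" and sub: "\<SS> \<subseteq> PL"
    and x: "x \<in> mspace (union_metric \<SS>)"
  obtains e where "0 < e"
    "\<And>y. y \<in> mspace (union_metric \<SS>) \<Longrightarrow> y \<noteq> x \<Longrightarrow> e \<le> mdist (union_metric \<SS>) x y"
proof -
  obtain Y where Y: "Y \<in> \<SS>" "x \<in> mspace Y"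
    using x by (auto simp: mspace_union_metric[OF disj sub])
  let ?D = "mdist Y x ` (mspace Y - {x})"
  have fin: "finite (mspace Y)"
    using Y sub PL_card(1) by blast
  have "pseudo_linear_quadruple Y"
    using Y sub by (auto simp: PL_def)
  then obtain w where w: "w \<in> mspace Y" "w \<noteq> x"
    using Y(2) pseudo_linear_quadruple_nontrivial by metis
  have "Min ?D \<in> ?D"
    using fin w by (intro Min_in) auto
  then have pos: "0 < Min ?D"
    using Y(2) mdist_nonneg mdist_zero by (smt (verit) DiffD1 DiffD2 imageE insertI1)
  show thesis
  proof (rule that[OF pos])
    fix y assume y: "y \<in> mspace (union_metric \<SS>)" "y \<noteq> x"
    then obtain Z where Z: "Z \<in> \<SS>" "y \<in> mspace Z"
      by (auto simp: mspace_union_metric[OF disj sub])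
    note dxy = mdist_union_metric[OF disj sub Y(1) Z(1) Y(2) Z(2)]
    show "Min ?D \<le> mdist (union_metric \<SS>) x y"
    proof (cases "Y = Z")
      case True
      then show ?thesis
        using dxy fin y Z by (auto intro!: Min_le)
    next
      case False
      have "Min ?D \<le> mdist Y x w"
        using fin w by (intro Min_le) auto
      also have "\<dots> \<le> mdiameter Y"
        using fin w Y by (intro mdist_le_mdiameter)
      finally show ?thesis
        using dxy False by simp
    qed
  qed
qed

text \<open>
  A point of the union has no other point of the extension within distance \<open>min e r\<close>, where
  \<open>e\<close> isolates it in the union, whereas a copy of the line has points at every distance
  from each of its points.
\<close>

lemma line_metric_contains_line:
  fixes f :: "real \<Rightarrow> 'a + real"
  assumes disj: "disjoint_family_on mspace \<SS>" and sub: "\<SS> \<subseteq> PL" and r: "0 < r"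
    and f: "range f \<subseteq> mspace (union_metric \<SS>) <+> UNIV"
      "\<And>s t. line_dist (union_metric \<SS>) b p r (f s) (f t) = \<bar>s - t\<bar>"
  shows "range f = range Inr"
proof -
  let ?X = "union_metric \<SS>"
  have "\<exists>t. f s = Inr t" for s
  proof (rule ccontr)
    assume "\<nexists>t. f s = Inr t"
    then obtain x where fs: "f s = Inl x"
      by (cases "f s") auto
    moreover have "f s \<in> mspace ?X <+> UNIV"
      using f(1) by blast
    ultimately have "x \<in> mspace ?X"
      by auto
    then obtain e where e: "0 < e"
      "\<And>y. y \<in> mspace ?X \<Longrightarrow> y \<noteq> x \<Longrightarrow> e \<le> mdist ?X x y"
      by (rule union_metric_isolated[OF disj sub]) blast
    define t where "t = min e r / 2"
    have t: "0 < t" "t < e" "t < r"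
      using e(1) r by (auto simp: t_def min_def)
    have d: "line_dist ?X b p r (f s) (f (s + t)) = t"
      using f(2)[of s "s + t"] t by simp
    show False
    proof (cases "f (s + t)")
      case (Inl y)
      moreover have "f (s + t) \<in> mspace ?X <+> UNIV"
        using f(1) by blast
      ultimately have y: "y \<in> mspace ?X" "mdist ?X x y = t"
        using d fs by auto
      then have "y \<noteq> x"
        using t(1) by (metis mdist_zero less_irrefl)
      then show False
        using e(2)[of y] y t(2) by simp
    next
      case (Inr u)
      with d fs have "\<bar>u - p\<bar> + r + mdist ?X b x = t"
        by simp
      with t(3) show False
        using mdist_nonneg[of ?X b x] by linarith
    qed
  qed
  then obtain g where g: "\<And>s. f s = Inr (g s)"
    by metis
  have "surj g"
    using f(2) by (intro real_isometry_surj) (auto simp: g)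
  then show ?thesis
    by (auto simp: g image_iff)
qed

section \<open>The line extension is minimal universal\<close>

theorem theorem7p15:
  fixes PL1 :: "'x metric set" and b :: 'x and p r :: real
  assumes "(UNIV :: real set) \<lesssim> (UNIV :: 'z set)"
    and "PL1 \<subseteq> PL"
    and "disjoint_family_on mspace PL1"
    and "minimal_universal_class (PL :: 'x metric set) PL1"
    and "b \<in> (\<Union>Y\<in>PL1. mspace Y)"
    and "0 < r"
  shows "minimal_universal (MB :: 'z metric set) (line_metric (union_metric PL1) b p r)"
proof -
  let ?X = "union_metric PL1"
  let ?M = "line_metric ?X b p r"
  note sub = assms(2) and disj = assms(3) and r = assms(6)
  have X: "mspace ?X = (\<Union>Y\<in>PL1. mspace Y)"
    by (rule mspace_union_metric[OF disj sub])
  then have b: "b \<in> mspace ?X"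
    using assms(5) by simp
  note M = mspace_line_metric[OF b r] mdist_line_metric[OF b r]
  obtain \<iota> :: "real \<Rightarrow> 'z" where \<iota>: "inj \<iota>"
    using assms(1) unfolding lepoll_def by blast
  have PL1_univ: "\<forall>Z\<in>(PL :: 'x metric set). \<exists>Y\<in>PL1. isometrically_embeds Z Y"
    using assms(4) by (simp add: minimal_universal_class_def class_embeds_def)
  have PL1_antichain: "\<forall>Y\<in>PL1. \<forall>Z\<in>PL1. Y \<noteq> Z \<longrightarrow> \<not> isometrically_embeds Y Z"
    using assms(4) by (simp add: minimal_universal_class_def)
  show ?thesis
    unfolding minimal_universal_def
  proof (intro conjI allI impI)
    show "universal_for (MB :: 'z metric set) ?M"
      unfolding universal_for_def
    proof
      fix Z :: "'z metric" assume Z: "Z \<in> MB"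
      show "isometrically_embeds Z ?M"
      proof (cases "isometrically_embeds Z (euclidean_metric :: real metric)")
        case True
        moreover have "isometrically_embeds (euclidean_metric :: real metric) ?M"
          unfolding isometrically_embeds_def M by (intro exI[of _ Inr]) (auto simp: dist_real_def)
        ultimately show ?thesis
          by (rule isometrically_embeds_trans)
      next
        case False
        with Z have "Z \<in> PL"
          by (simp add: PL_def pseudo_linear_quadruple_iff_MB)
        obtain B where "B \<in> PL1"
          using assms(5) by blast
        with sub have "B \<in> PL"
          by blast
        with \<open>Z \<in> PL\<close> have "card (mspace Z) = card (mspace B)" "finite (mspace Z)" "finite (mspace B)"
          by (simp_all add: PL_card)
        then obtain g where "bij_betw g (mspace Z) (mspace B)"
          using finite_same_card_bij by blast
        then have "inj_on g (mspace Z)"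
          by (rule bij_betw_imp_inj_on)
        then obtain Z' :: "'x metric" where Z': "isometrically_embeds Z Z'" "isometrically_embeds Z' Z"
          by (rule isometric_copy) blast
        have "Z' \<in> MB"
          using Z'(2) Z by (rule MB_embeds)
        moreover have "\<not> isometrically_embeds Z' (euclidean_metric :: real metric)"
          using False isometrically_embeds_trans[OF Z'(1)] by blast
        ultimately have "Z' \<in> PL"
          by (simp add: PL_def pseudo_linear_quadruple_iff_MB)
        then obtain Y where Y: "Y \<in> PL1" "isometrically_embeds Z' Y"
          using PL1_univ by blast
        have "isometrically_embeds Y ?M"
          unfolding isometrically_embeds_def M
          using Y(1) by (intro exI[of _ Inl]) (auto simp: X mdist_union_metric[OF disj sub])
        with Y(2) have "isometrically_embeds Z' ?M"
          by (rule isometrically_embeds_trans)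
        with Z'(1) show ?thesis
          by (rule isometrically_embeds_trans)
      qed
    qed
  next
    fix Y0 assume Y0: "Y0 \<subseteq> mspace ?M"
      and univ: "universal_for (MB :: 'z metric set) (submetric ?M Y0)"
    \<comment> \<open>Universality of \<open>Y0\<close> concerns spaces over the type \<open>'z\<close> only; it applies to the
      line and to the members of \<open>PL1\<close> because these inject into \<open>'z\<close>.\<close>
    have copy: "\<exists>f. f ` mspace Z \<subseteq> Y0 \<and>
        (\<forall>x\<in>mspace Z. \<forall>y\<in>mspace Z. mdist ?M (f x) (f y) = mdist Z x y)"
      if Z: "Z \<in> MB" and inj: "inj_on g (mspace Z)" for Z :: "'c metric" and g :: "'c \<Rightarrow> 'z"
    proof -
      from inj obtain Z' :: "'z metric" where Z': "isometrically_embeds Z Z'" "isometrically_embeds Z' Z"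
        by (rule isometric_copy) blast
      have "Z' \<in> MB"
        using Z'(2) Z by (rule MB_embeds)
      with univ have "isometrically_embeds Z' (submetric ?M Y0)"
        unfolding universal_for_def by blast
      with Z'(1) have "isometrically_embeds Z (submetric ?M Y0)"
        by (rule isometrically_embeds_trans)
      then show ?thesis
        unfolding isometrically_embeds_def by auto
    qed
    have line: "range Inr \<subseteq> Y0"
    proof -
      have "inj_on \<iota> (mspace euclidean_metric)"
        using \<iota> by simp
      from copy[OF euclidean_real_in_MB this] obtain f where f: "range f \<subseteq> Y0"
        "\<And>s t. line_dist ?X b p r (f s) (f t) = \<bar>s - t\<bar>"
        unfolding M by (auto simp: dist_real_def)
      have "range f \<subseteq> mspace ?X <+> UNIV"
        using f(1) Y0 unfolding M by (rule subset_trans)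
      from line_metric_contains_line[OF disj sub r this f(2)] f(1) show ?thesis
        by simp
    qed
    have quad: "Inl ` mspace Q \<subseteq> Y0" if Q: "Q \<in> PL1" for Q
    proof -
      have pl: "Q \<in> PL" "Q \<in> MB" "\<not> isometrically_embeds Q (euclidean_metric :: real metric)"
        using Q sub by (auto simp: PL_def pseudo_linear_quadruple_iff_MB)
      obtain p0 p1 p2 p3 where ps: "mspace Q = {p0, p1, p2, p3}" "pl_cycle (mdist Q) p0 p1 p2 p3"
        using pl(2,3) by (rule MB_not_linear_imp_pl_cycle)
      obtain n :: "'x \<Rightarrow> nat" where n: "inj_on n (mspace Q)"
        using finite_imp_inj_to_nat_seg[OF PL_card(1)[OF pl(1)]] by blast
      have "inj_on (\<lambda>x. \<iota> (real (n x))) (mspace Q)"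
        using injD[OF \<iota>] inj_onD[OF n] by (intro inj_onI) (metis of_nat_eq_iff)
      from copy[OF pl(2) this] obtain f where f: "f ` mspace Q \<subseteq> Y0"
        "\<And>x y. x \<in> mspace Q \<Longrightarrow> y \<in> mspace Q \<Longrightarrow> line_dist ?X b p r (f x) (f y) = mdist Q x y"
        unfolding M by blast
      have fM: "f x \<in> mspace ?X <+> UNIV" if "x \<in> mspace Q" for x
        using that f(1) Y0 unfolding M by blast
      have p: "p0 \<in> mspace Q" "p1 \<in> mspace Q" "p2 \<in> mspace Q" "p3 \<in> mspace Q"
        using ps(1) by auto
      have "pl_cycle (line_dist ?X b p r) (f p0) (f p1) (f p2) (f p3)"
        using ps(2) p unfolding pl_cycle_def by (simp add: f(2))
      from pl_cycle_in_line_metric[OF b r fM[OF p(1)] fM[OF p(2)] fM[OF p(3)] fM[OF p(4)] this]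
      have "f ` mspace Q \<subseteq> range Inl \<or> f ` mspace Q \<subseteq> range Inr"
        by (simp add: ps(1))
      moreover have "\<not> f ` mspace Q \<subseteq> range Inr"
      proof
        assume "f ` mspace Q \<subseteq> range Inr"
        then have "\<forall>x\<in>mspace Q. \<exists>s. f x = Inr s"
          by blast
        then obtain g where g: "\<And>x. x \<in> mspace Q \<Longrightarrow> f x = Inr (g x)"
          unfolding bchoice_iff by blast
        have "isometrically_embeds Q (euclidean_metric :: real metric)"
          unfolding isometrically_embeds_def
          using f(2) by (intro exI[of _ g]) (auto simp: g dist_real_def)
        with pl(3) show False by blast
      qed
      ultimately have "f ` mspace Q \<subseteq> range Inl"
        by blast
      then have "\<forall>x\<in>mspace Q. \<exists>y. f x = Inl y"
        by blast
      then obtain h where h: "\<And>x. x \<in> mspace Q \<Longrightarrow> f x = Inl (h x)"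
        unfolding bchoice_iff by blast
      have hX: "h x \<in> mspace ?X" if "x \<in> mspace Q" for x
        using fM[OF that] h[OF that] by auto
      have hd: "mdist ?X (h x) (h y) = mdist Q x y" if "x \<in> mspace Q" "y \<in> mspace Q" for x y
        using f(2)[OF that] h that by simp
      have "pl_cycle (mdist ?X) (h p0) (h p1) (h p2) (h p3)"
        using ps(2) p unfolding pl_cycle_def by (simp add: hd)
      then obtain Y where Y: "Y \<in> PL1" "{h p0, h p1, h p2, h p3} \<subseteq> mspace Y"
        by (rule pl_cycle_in_union[OF disj sub hX[OF p(1)] hX[OF p(2)] hX[OF p(3)] hX[OF p(4)]])
      then have hY: "h ` mspace Q \<subseteq> mspace Y"
        by (simp add: ps(1))
      have hY': "h x \<in> mspace Y" if "x \<in> mspace Q" for x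
        using hY that by blast
      have hdY: "mdist Y (h x) (h y) = mdist Q x y" if "x \<in> mspace Q" "y \<in> mspace Q" for x y
        using hd[OF that] mdist_union_metric[OF disj sub Y(1) Y(1) hY'[OF that(1)] hY'[OF that(2)]]
        by simp
      have "isometrically_embeds Q Y"
        unfolding isometrically_embeds_def using hY hdY by blast
      then have "Y = Q"
        using PL1_antichain[rule_format, OF Q Y(1)] by blast
      with hY have "h ` mspace Q = mspace Q"
        using isometry_inj_on[OF hY hdY] PL_card(1)[OF pl(1)] by (intro endo_inj_surj) auto
      moreover have "f ` mspace Q = Inl ` h ` mspace Q"
        unfolding image_image by (rule image_cong[OF refl h])
      ultimately show ?thesis
        using f(1) by simp
    qed
    have "mspace ?M \<subseteq> Y0"
      unfolding M X
    proof
      fix x assume "x \<in> (\<Union>Q\<in>PL1. mspace Q) <+> (UNIV :: real set)"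
      then consider Q y where "Q \<in> PL1" "y \<in> mspace Q" "x = Inl y" | t where "x = Inr t"
        by blast
      then show "x \<in> Y0"
        using line quad by cases blast+
    qed
    with Y0 show "Y0 = mspace ?M"
      by (rule subset_antisym)
  qed
qed

end
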